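(* Let \((X, \tau)\) be an ultrametrizable infinite topological space. Then the following conditions are equivalent: (i) The space \((X, \tau)\) is compact. (ii) For every ultrametric \(d\) on \(X\) compatible with \(\tau\), the distance set \(D(X, d)\) has the order type \(\mathbf{1} + \boldsymbol{\omega}^{*}\). (iii) If \((X, d)\) and \((X, \rho)\) are ultrametric spaces such that \(\tau_d = \tau = \tau_{\rho}\), then the distance sets \(D(X, d)\) and \(D(X, \rho)\) are order isomorphic as subposets of \((\mathbb{R}^{+}, \leqslant)\). (iv) For every ultrametric \(d\) on \(X\) compatible with \(\tau\), the distance set \(D(X, d)\) has the largest element.
   Context: \(\mathbb{R}^{+}\) is the set of all nonnegative real numbers with its standard order \(\leqslant\). An ultrametric on \(X\) is a metric \(d\colon X\times X\to\mathbb{R}^{+}\) satisfying \(d(x,y)\leqslant\max\{d(x,z),d(z,y)\}\) for all \(x,y,z\in X\). For a metric \(d\) on \(X\), \(\tau_d\) denotes the topology on \(X\) whose base is the set of all open balls \(B_r(c)=\{x\in X: d(c,x)<r\}\), \(c\in X\), \(r>0\). An ultrametric \(d\) on \(X\) is compatible with a topology \(\tau\) on \(X\) if \(\tau=\tau_d\); \((X,\tau)\) is ultrametrizable if there is an ultrametric on \(X\) compatible with \(\tau\). Compactness means that every open cover has a finite subcover. The distance set of an ultrametric space \((X,d)\) is \(D(X,d)=\{d(x,y): x,y\in X\}\), regarded as a totally ordered subset (subposet) of \((\mathbb{R}^{+},\leqslant)\). Two posets are order isomorphic if there is an order-preserving bijection between them whose inverse is also order-preserving. A poset has the order type \(\mathbf{1}+\boldsymbol{\omega}^{*}\)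 if it is order isomorphic to the totally ordered set \(\{-\infty\}\cup\{\ldots,-3,-2,-1\}\), where the negative integers carry the usual order and \(-\infty\) is the smallest element. *)

theory Defs
  imports "HOL-Analysis.Analysis"
begin

text \<open>As in \<^locale>\<open>Metric_space\<close>, the function \<open>d\<close> is total on the type but only its values on
  \<open>M\<close> matter. The locale asks for nonnegativity and symmetry on the whole type, which is no
  restriction: a metric given on \<open>M\<close> can be extended by 0 to arguments outside \<open>M\<close>.\<close>

locale Ultrametric_space = Metric_space +
  assumes ultrametric:
    "\<lbrakk>x \<in> M; y \<in> M; z \<in> M\<rbrakk> \<Longrightarrow> d x y \<le> max (d x z) (d z y)"

definition compatible_ultrametric :: "'a topology \<Rightarrow> ('a \<Rightarrow> 'a \<Rightarrow> real) \<Rightarrow> bool" where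
  "compatible_ultrametric \<tau> d \<longleftrightarrow>
     Ultrametric_space (topspace \<tau>) d \<and> \<tau> = Metric_space.mtopology (topspace \<tau>) d"

definition ultrametrizable :: "'a topology \<Rightarrow> bool" where
  "ultrametrizable \<tau> \<longleftrightarrow> (\<exists>d. compatible_ultrametric \<tau> d)"

definition distance_set :: "'a set \<Rightarrow> ('a \<Rightarrow> 'a \<Rightarrow> real) \<Rightarrow> real set" where
  "distance_set X d = {d x y | x y. x \<in> X \<and> y \<in> X}"

text \<open>The sets \<open>A\<close> and \<open>B\<close> carry the orders induced from their types.\<close>

definition order_isomorphic :: "'a::order set \<Rightarrow> 'b::order set \<Rightarrow> bool" where
  "order_isomorphic A B \<longleftrightarrow>
     (\<exists>f. bij_betw f A B \<and> mono_on A f \<and> mono_on B (inv_into A f))"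

text \<open>The poset consisting of the negative integers with a smallest element \<open>-\<infinity>\<close> adjoined,
  realised inside the extended reals.\<close>

definition one_plus_omega_star :: "ereal set" where
  "one_plus_omega_star = {-\<infinity>} \<union> {ereal (real_of_int k) | k. k < 0}"

definition has_order_type_one_plus_omega_star :: "'a::order set \<Rightarrow> bool" where
  "has_order_type_one_plus_omega_star A \<longleftrightarrow> order_isomorphic A one_plus_omega_star"

definition has_largest_element :: "'a::order set \<Rightarrow> bool" where
  "has_largest_element A \<longleftrightarrow> (\<exists>m\<in>A. \<forall>a\<in>A. a \<le> m)"

end

theory Submission
  imports Defs
begin

text \<open>
  Everything rests on one property of an ultrametric: two balls are disjoint or one of them contains
  the other.

  In a compact space finitely many balls of radius \<open>\<epsilon>\<close> suffice to cover, and every distance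
  \<open>\<ge> \<epsilon>\<close> equals the distance between two of the finitely many centres. So only finitely many
  distances are \<open>\<ge> \<epsilon>\<close>, for each \<open>\<epsilon> > 0\<close>; and since the space is infinite, the balls
  cannot all be singletons, so there are arbitrarily small positive distances. A set of nonnegative
  reals containing 0 with these two properties is a zero together with a decreasing sequence tending
  to it, that is, it has the order type \<open>1 + \<omega>\<^sup>*\<close>
  (\<open>compact_distance_set_order_type\<close>). This determines the distance set up to isomorphism and
  gives it a largest element.

  Conversely, a space that is not compact contains a sequence of distinct points without accumulation
  points. Suitable balls around these points are disjoint, and every point outside them has a
  neighbourhood missing all of them. Hence the function that is \<open>n\<close> on the \<open>n\<close>-th ball and 0
  elsewhere is locally constant and unbounded (\<open>noncompact_unbounded_locally_constant\<close>).
  Forcing points with different values \<open>a\<close>, \<open>b\<close> of this function to be at least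
  \<open>max a b\<close> apart leaves the distances from each point to all nearby points unchanged,
  and hence the topology, but makes the distance set unbounded (\<open>noncompact_distance_set_without_largest\<close>). On the other hand, every infinite
  ultrametrizable space has a compatible ultrametric that attains its largest distance: cut an
  arbitrary one off at one of its positive values. So if the space is not compact, then each of the
  three conditions on the distance sets fails.
\<close>

section \<open>Order isomorphisms\<close>

lemma order_isomorphic_iff:
  "order_isomorphic A B \<longleftrightarrow>
     (\<exists>f. bij_betw f A B \<and> (\<forall>x\<in>A. \<forall>y\<in>A. x \<le> y \<longleftrightarrow> f x \<le> f y))"
proof
  assume "order_isomorphic A B"
  then obtain f where f: "bij_betw f A B" "mono_on A f" "mono_on B (inv_into A f)"
    unfolding order_isomorphic_def by blast
  have "x \<le> y \<longleftrightarrow> f x \<le> f y" if "x \<in> A" "y \<in> A" for x y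
  proof
    assume "x \<le> y"
    then show "f x \<le> f y"
      using f(2) that by (simp add: mono_onD)
  next
    assume "f x \<le> f y"
    moreover have "f x \<in> B" "f y \<in> B"
      using f(1) that by (auto simp: bij_betw_def)
    ultimately have "inv_into A f (f x) \<le> inv_into A f (f y)"
      using f(3) by (simp add: mono_onD)
    then show "x \<le> y"
      using f(1) that by (simp add: bij_betw_inv_into_left)
  qed
  with f(1) show "\<exists>f. bij_betw f A B \<and> (\<forall>x\<in>A. \<forall>y\<in>A. x \<le> y \<longleftrightarrow> f x \<le> f y)"
    by blast
next
  assume "\<exists>f. bij_betw f A B \<and> (\<forall>x\<in>A. \<forall>y\<in>A. x \<le> y \<longleftrightarrow> f x \<le> f y)"
  then obtain f where f: "bij_betw f A B"
    and le: "\<And>x y. x \<in> A \<Longrightarrow> y \<in> A \<Longrightarrow> x \<le> y \<longleftrightarrow> f x \<le> f y"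
    by blast
  have "inv_into A f b \<le> inv_into A f b'" if "b \<in> B" "b' \<in> B" "b \<le> b'" for b b'
  proof -
    have "inv_into A f b \<in> A" "inv_into A f b' \<in> A"
      using f that by (metis bij_betw_def inv_into_into)+
    then show ?thesis
      using le f that by (simp add: bij_betw_inv_into_right)
  qed
  then show "order_isomorphic A B"
    unfolding order_isomorphic_def using f le by (auto intro!: exI[of _ f] mono_onI)
qed

lemma order_isomorphic_sym: "order_isomorphic A B \<Longrightarrow> order_isomorphic B A"
proof -
  assume "order_isomorphic A B"
  then obtain f where f: "bij_betw f A B" "\<forall>x\<in>A. \<forall>y\<in>A. x \<le> y \<longleftrightarrow> f x \<le> f y"
    unfolding order_isomorphic_iff by blast
  have "inv_into A f b \<in> A" if "b \<in> B" for b
    using bij_betw_apply[OF bij_betw_inv_into[OF f(1)] that] .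
  then have "\<forall>x\<in>B. \<forall>y\<in>B. x \<le> y \<longleftrightarrow> inv_into A f x \<le> inv_into A f y"
    using f by (simp add: bij_betw_inv_into_right)
  then show "order_isomorphic B A"
    unfolding order_isomorphic_iff using bij_betw_inv_into[OF f(1)] by blast
qed

lemma order_isomorphic_trans:
  assumes "order_isomorphic A B" "order_isomorphic B C"
  shows "order_isomorphic A C"
proof -
  obtain f where f: "bij_betw f A B" "\<forall>x\<in>A. \<forall>y\<in>A. x \<le> y \<longleftrightarrow> f x \<le> f y"
    using assms(1) unfolding order_isomorphic_iff by blast
  obtain g where g: "bij_betw g B C" "\<forall>x\<in>B. \<forall>y\<in>B. x \<le> y \<longleftrightarrow> g x \<le> g y"
    using assms(2) unfolding order_isomorphic_iff by blast
  have "f x \<in> B" if "x \<in> A" for x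
    using f(1) that by (auto simp: bij_betw_def)
  then have "\<forall>x\<in>A. \<forall>y\<in>A. x \<le> y \<longleftrightarrow> (g \<circ> f) x \<le> (g \<circ> f) y"
    using f(2) g(2) by simp
  moreover have "bij_betw (g \<circ> f) A C"
    using f(1) g(1) by (rule bij_betw_trans)
  ultimately show ?thesis
    unfolding order_isomorphic_iff by blast
qed

lemma has_largest_element_order_isomorphic:
  assumes "order_isomorphic A B" "has_largest_element A"
  shows "has_largest_element B"
proof -
  obtain f where f: "bij_betw f A B" "\<forall>x\<in>A. \<forall>y\<in>A. x \<le> y \<longleftrightarrow> f x \<le> f y"
    using assms(1) unfolding order_isomorphic_iff by blast
  obtain m where m: "m \<in> A" "\<forall>a\<in>A. a \<le> m"
    using assms(2) unfolding has_largest_element_def by blast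
  have "f m \<in> B" "\<forall>b\<in>B. b \<le> f m"
    using f m unfolding bij_betw_def by auto
  then show ?thesis
    unfolding has_largest_element_def by blast
qed

lemma has_largest_element_one_plus_omega_star: "has_largest_element one_plus_omega_star"
  unfolding has_largest_element_def
proof (intro bexI ballI)
  show "ereal (real_of_int (-1)) \<in> one_plus_omega_star"
    unfolding one_plus_omega_star_def by fastforce
  show "a \<le> ereal (real_of_int (-1))" if "a \<in> one_plus_omega_star" for a
    using that unfolding one_plus_omega_star_def by auto
qed

text \<open>
  Counting the elements of \<open>A\<close> from the largest one downwards gives the isomorphism: a positive
  element goes to the negative of its position. Every position occurs, because below any positive
  element there is a next smaller one.
\<close>

lemma has_order_type_one_plus_omega_starI:
  fixes A :: "real set"
  assumes nonneg: "\<And>a. a \<in> A \<Longrightarrow> 0 \<le> a" and zero: "0 \<in> A"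
    and fin: "\<And>e. 0 < e \<Longrightarrow> finite {a \<in> A. e \<le> a}"
    and small: "\<And>e. 0 < e \<Longrightarrow> \<exists>a\<in>A. 0 < a \<and> a < e"
  shows "has_order_type_one_plus_omega_star A"
proof -
  define c where "c a = card {b \<in> A. a \<le> b}" for a
  define f where "f a = (if a = 0 then -\<infinity> else ereal (real_of_int (- int (c a))))" for a
  have c_pos: "0 < c a" if "a \<in> A" "0 < a" for a
    unfolding c_def using fin[OF that(2)] that(1) by (auto simp: card_gt_0_iff)
  have c_less: "c b < c a" if "a \<in> A" "0 < a" "a < b" for a b
    unfolding c_def
  proof (rule psubset_card_mono)
    show "finite {b \<in> A. a \<le> b}"
      by (rule fin[OF that(2)])
    show "{y \<in> A. b \<le> y} \<subset> {y \<in> A. a \<le> y}"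
      using that by (intro psubsetI) (auto simp: set_eq_iff intro!: exI[of _ a])
  qed
  have f_less: "f a < f b" if "a \<in> A" "b \<in> A" "a < b" for a b
    using nonneg[OF that(1)] c_less[of a b] that by (auto simp: f_def)
  have c_surj: "\<exists>a\<in>A. 0 < a \<and> c a = Suc n" for n
  proof -
    \<comment> \<open>The largest positive element below \<open>u\<close>; it serves both as the start and for the step
      of the induction.\<close>
    have below: "\<exists>m\<in>A. 0 < m \<and> m < u \<and> (\<forall>b\<in>A. b < u \<longrightarrow> b \<le> m)" if u: "0 < u" for u
    proof -
      obtain e where e: "e \<in> A" "0 < e" "e < u"
        using small[OF u] by blast
      let ?B = "{b \<in> A. e \<le> b \<and> b < u}"
      have B: "finite ?B" "e \<in> ?B"
        using e finite_subset[OF _ fin[OF e(2)], of ?B] by auto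
      then have "Max ?B \<in> ?B"
        using Max_in by blast
      moreover have "e \<le> Max ?B"
        using B by simp
      moreover have "b \<le> Max ?B" if "b \<in> A" "b < u" for b
      proof (cases "e \<le> b")
        case True
        then show ?thesis
          using B(1) that by simp
      next
        case False
        then show ?thesis
          using \<open>e \<le> Max ?B\<close> by linarith
      qed
      ultimately show ?thesis
        using e(2) by (intro bexI[of _ "Max ?B"]) auto
    qed
    show ?thesis
    proof (induction n)
      case 0
      obtain a where a: "a \<in> A" "0 < a"
        using small[of 1] by auto
      let ?B = "{b \<in> A. a \<le> b}"
      have B: "finite ?B" "a \<in> ?B"
        using a fin by auto
      have M: "Max ?B \<in> ?B"
        using B Max_in by blast
      have "{b \<in> A. Max ?B \<le> b} = {Max ?B}"
      proof (intro equalityI subsetI)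
        fix b assume "b \<in> {b \<in> A. Max ?B \<le> b}"
        then have "b \<in> A" "Max ?B \<le> b" "a \<le> b"
          using M by auto
        then show "b \<in> {Max ?B}"
          using B(1) by (simp add: antisym)
      qed (use M in auto)
      then have "c (Max ?B) = Suc 0"
        by (simp add: c_def)
      with M a show ?case
        by (intro bexI[of _ "Max ?B"]) auto
    next
      case (Suc n)
      then obtain a where a: "a \<in> A" "0 < a" "c a = Suc n"
        by blast
      obtain m where m: "m \<in> A" "0 < m" "m < a" "\<And>b. b \<in> A \<Longrightarrow> b < a \<Longrightarrow> b \<le> m"
        using below[OF a(2)] by blast
      have "{b \<in> A. m \<le> b} = insert m {b \<in> A. a \<le> b}"
        using m by fastforce
      then have "c m = Suc (c a)"
        using fin[OF a(2)] m(3) by (simp add: c_def)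
      with a m show ?case
        by auto
    qed
  qed
  have image: "f ` A = one_plus_omega_star"
  proof (intro equalityI subsetI)
    fix y assume "y \<in> f ` A"
    then obtain a where a: "a \<in> A" "y = f a"
      by blast
    show "y \<in> one_plus_omega_star"
    proof (cases "a = 0")
      case False
      then have "0 < c a"
        using nonneg[OF a(1)] c_pos[OF a(1)] by simp
      then have "- int (c a) < 0"
        by simp
      moreover have "y = ereal (real_of_int (- int (c a)))"
        using False a(2) by (simp add: f_def)
      ultimately show ?thesis
        unfolding one_plus_omega_star_def by blast
    qed (use a in \<open>simp add: f_def one_plus_omega_star_def\<close>)
  next
    fix y assume y: "y \<in> one_plus_omega_star"
    show "y \<in> f ` A"
    proof (cases "y = -\<infinity>")
      case True
      then show ?thesis
        using zero by (auto simp: f_def intro!: image_eqI[of _ _ 0])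
    next
      case False
      then obtain k :: int where k: "k < 0" "y = ereal (real_of_int k)"
        using y unfolding one_plus_omega_star_def by auto
      obtain a where a: "a \<in> A" "0 < a" "c a = Suc (nat (- k) - 1)"
        using c_surj by blast
      then have "- int (c a) = k"
        using k by simp
      then have "f a = y"
        using a k unfolding f_def by simp
      with a show ?thesis
        by blast
    qed
  qed
  have f_le: "a \<le> b \<longleftrightarrow> f a \<le> f b" if "a \<in> A" "b \<in> A" for a b
    using f_less[of a b] f_less[of b a] that by (cases a b rule: linorder_cases) auto
  then have "inj_on f A"
    by (intro inj_onI antisym) auto
  with image f_le show ?thesis
    unfolding has_order_type_one_plus_omega_star_def order_isomorphic_iff bij_betw_def by blast
qed

section \<open>Compact spaces\<close>

text \<open>
  If \<open>x\<close> and \<open>y\<close> are closer to \<open>a\<close> and \<open>b\<close> than \<open>e \<le> d x y\<close>, then the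
  strong triangle inequality forces \<open>d x y = d a b\<close>, as in a triangle the two longest sides
  are equal.
\<close>

lemma (in Ultrametric_space) dist_eq_if_close:
  assumes M: "x \<in> M" "y \<in> M" "a \<in> M" "b \<in> M"
    and close: "d a x < e" "d b y < e" and far: "e \<le> d x y"
  shows "d x y = d a b"
proof (rule antisym)
  have "d x y \<le> max (d x a) (max (d a b) (d b y))"
    using ultrametric[of x y a] ultrametric[of a y b] M by linarith
  then show "d x y \<le> d a b"
    using close far commute[of x a] by linarith
  have "d a b \<le> max (d a x) (max (d x y) (d y b))"
    using ultrametric[of a b x] ultrametric[of x b y] M by linarith
  then show "d a b \<le> d x y"
    using close far commute[of y b] by linarith
qed

lemma compact_distance_set_order_type:
  assumes comp: "compact_space \<tau>" and inf: "infinite (topspace \<tau>)"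
    and compat: "compatible_ultrametric \<tau> d"
  shows "has_order_type_one_plus_omega_star (distance_set (topspace \<tau>) d)"
proof -
  define X where "X = topspace \<tau>"
  interpret Ultrametric_space X d
    using compat unfolding compatible_ultrametric_def X_def by blast
  have "compact_space mtopology"
    using comp compat unfolding compatible_ultrametric_def X_def by metis
  then have "mtotally_bounded X"
    by (simp add: compact_space_eq_mcomplete_mtotally_bounded)
  then have net: "\<exists>K. finite K \<and> K \<subseteq> X \<and> X \<subseteq> (\<Union>x\<in>K. mball x e)" if "0 < e" for e
    using that unfolding mtotally_bounded_def by blast
  have "has_order_type_one_plus_omega_star (distance_set X d)"
  proof (rule has_order_type_one_plus_omega_starI)
    show "0 \<le> a" if "a \<in> distance_set X d" for a
      using that by (auto simp: distance_set_def)
    obtain x where "x \<in> X"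
      using inf infinite_imp_nonempty unfolding X_def by blast
    then have "0 = d x x"
      by simp
    with \<open>x \<in> X\<close> show "0 \<in> distance_set X d"
      unfolding distance_set_def by blast
  next
    fix e :: real assume e: "0 < e"
    obtain K where K: "finite K" "K \<subseteq> X" "X \<subseteq> (\<Union>x\<in>K. mball x e)"
      using net[OF e] by (elim exE conjE that)
    have "{a \<in> distance_set X d. e \<le> a} \<subseteq> (\<lambda>(a, b). d a b) ` (K \<times> K)"
    proof
      fix t assume "t \<in> {a \<in> distance_set X d. e \<le> a}"
      then obtain x y where xy: "x \<in> X" "y \<in> X" "t = d x y" "e \<le> d x y"
        unfolding distance_set_def by blast
      obtain a b where ab: "a \<in> K" "x \<in> mball a e" "b \<in> K" "y \<in> mball b e"
        using K(3) xy(1,2) by blast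
      then have "d x y = d a b"
        using dist_eq_if_close[of x y a b e] xy(4) by simp
      with xy(3) ab(1,3) show "t \<in> (\<lambda>(a, b). d a b) ` (K \<times> K)"
        by (intro image_eqI[of _ _ "(a, b)"]) auto
    qed
    then show "finite {a \<in> distance_set X d. e \<le> a}"
      using K(1) finite_subset by blast
    show "\<exists>a\<in>distance_set X d. 0 < a \<and> a < e"
    proof (rule ccontr)
      \<comment> \<open>Otherwise balls of radius \<open>e\<close> are singletons, and finitely many of them cover.\<close>
      assume no: "\<not> ?thesis"
      have "x \<in> K" if x: "x \<in> X" for x
      proof -
        obtain a where "a \<in> K" "x \<in> mball a e"
          using K(3) x by blast
        then have a: "a \<in> K" "a \<in> X" "d a x < e"
          by simp_all
        then have "d a x \<in> distance_set X d"
          unfolding distance_set_def using x by blast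
        then have "\<not> 0 < d a x"
          using no a(3) by blast
        then have "d a x = 0"
          using nonneg[of a x] by linarith
        then show "x \<in> K"
          using a x by simp
      qed
      then have "finite X"
        using finite_subset[OF subsetI K(1)] by blast
      then show False
        using inf by (simp add: X_def)
    qed
  qed
  then show ?thesis
    by (simp add: X_def)
qed

section \<open>Changing the ultrametric within its topology\<close>

lemma mtopology_eq_if_locally_eq:
  assumes "Metric_space M d" "Metric_space M \<rho>"
    and loc: "\<And>x. x \<in> M \<Longrightarrow>
      \<exists>e>0. \<forall>y\<in>M. d x y < e \<or> \<rho> x y < e \<longrightarrow> d x y = \<rho> x y"
  shows "Metric_space.mtopology M d = Metric_space.mtopology M \<rho>"
proof -
  interpret D: Metric_space M d by fact
  interpret R: Metric_space M \<rho> by fact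
  have "(\<exists>r>0. D.mball x r \<subseteq> U) \<longleftrightarrow> (\<exists>r>0. R.mball x r \<subseteq> U)" if x: "x \<in> M" for x U
  proof -
    obtain e where e: "0 < e" "\<And>y. y \<in> M \<Longrightarrow> d x y < e \<or> \<rho> x y < e \<Longrightarrow> d x y = \<rho> x y"
      using loc[OF x] by blast
    \<comment> \<open>Shrunk to radius at most \<open>e\<close>, the balls of both metrics coincide.\<close>
    have "\<rho> x y = d x y" if "y \<in> M" "d x y < e" for y
      using e(2)[of y] that by simp
    then have DR: "D.mball x (min r e) \<subseteq> R.mball x r" for r
      by (auto simp: D.mball_def R.mball_def)
    have "d x y = \<rho> x y" if "y \<in> M" "\<rho> x y < e" for y
      using e(2)[of y] that by simp
    then have RD: "R.mball x (min r e) \<subseteq> D.mball x r" for r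
      by (auto simp: D.mball_def R.mball_def)
    have pos: "0 < min r e" if "0 < r" for r
      using that e(1) by simp
    show ?thesis
    proof
      assume "\<exists>r>0. D.mball x r \<subseteq> U"
      then obtain r where "0 < r" "D.mball x r \<subseteq> U"
        by blast
      then have "0 < min r e" "R.mball x (min r e) \<subseteq> U"
        using pos RD[of r] by auto
      then show "\<exists>r>0. R.mball x r \<subseteq> U"
        by blast
    next
      assume "\<exists>r>0. R.mball x r \<subseteq> U"
      then obtain r where "0 < r" "R.mball x r \<subseteq> U"
        by blast
      then have "0 < min r e" "D.mball x (min r e) \<subseteq> U"
        using pos DR[of r] by auto
      then show "\<exists>r>0. D.mball x r \<subseteq> U"
        by blast
    qed
  qed
  then show ?thesis
    unfolding topology_eq D.openin_mtopology R.openin_mtopology by blast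
qed

text \<open>Cutting an ultrametric off at one of its values makes that value the largest one.\<close>

lemma compatible_ultrametric_with_largest:
  assumes "ultrametrizable \<tau>" and inf: "infinite (topspace \<tau>)"
  shows "\<exists>d. compatible_ultrametric \<tau> d \<and> has_largest_element (distance_set (topspace \<tau>) d)"
proof -
  define X where "X = topspace \<tau>"
  obtain d where d: "Ultrametric_space X d" "\<tau> = Metric_space.mtopology X d"
    using assms(1) unfolding ultrametrizable_def compatible_ultrametric_def X_def by blast
  interpret Ultrametric_space X d by (rule d(1))
  obtain a b where ab: "a \<in> X" "b \<in> X" "a \<noteq> b"
    using inf infinite_arbitrarily_large[of X 2] unfolding X_def by (metis card_2_iff insert_subset)
  define c where "c = d a b"
  have c: "0 < c"
    unfolding c_def using ab by simp
  define \<rho> where "\<rho> x y = min (d x y) c" for x y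
  have \<rho>: "\<rho> x y \<le> max (\<rho> x z) (\<rho> z y)" if "x \<in> X" "y \<in> X" "z \<in> X" for x y z
    using ultrametric[OF that] unfolding \<rho>_def by linarith
  have \<rho>_nonneg: "0 \<le> \<rho> x y" for x y
    using c by (simp add: \<rho>_def)
  have U: "Ultrametric_space X \<rho>"
  proof
    show "0 \<le> \<rho> x y" for x y
      by (rule \<rho>_nonneg)
    show "\<rho> x y = \<rho> y x" for x y
      by (simp add: \<rho>_def commute)
    show "\<rho> x y = 0 \<longleftrightarrow> x = y" if "x \<in> X" "y \<in> X" for x y
      using that c by (auto simp: \<rho>_def min_def)
    show "\<rho> x z \<le> \<rho> x y + \<rho> y z" if "x \<in> X" "y \<in> X" "z \<in> X" for x y z
      using \<rho>[of x z y] \<rho>_nonneg[of x y] \<rho>_nonneg[of y z] that by linarith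
  qed (rule \<rho>)
  have "Metric_space.mtopology X d = Metric_space.mtopology X \<rho>"
  proof (rule mtopology_eq_if_locally_eq)
    show "Metric_space X \<rho>"
      using U by (rule Ultrametric_space.axioms)
    show "\<exists>e>0. \<forall>y\<in>X. d x y < e \<or> \<rho> x y < e \<longrightarrow> d x y = \<rho> x y" for x
      using c by (intro exI[of _ c]) (auto simp: \<rho>_def)
  qed (rule Metric_space_axioms)
  then have "compatible_ultrametric \<tau> \<rho>"
    using U d(2) unfolding compatible_ultrametric_def X_def by simp
  moreover have "has_largest_element (distance_set X \<rho>)"
    unfolding has_largest_element_def
  proof
    show "c \<in> distance_set X \<rho>"
      unfolding distance_set_def using ab by (force simp: \<rho>_def c_def)
    show "\<forall>t\<in>distance_set X \<rho>. t \<le> c"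
      unfolding distance_set_def by (auto simp: \<rho>_def)
  qed
  ultimately show ?thesis
    unfolding X_def by blast
qed

section \<open>Spaces that are not compact\<close>

text \<open>
  Take an infinite sequence of points \<open>s n\<close> without accumulation points and, for every point
  \<open>x\<close>, a radius \<open>r x\<close> such that no \<open>s n \<noteq> x\<close> lies in the ball around \<open>x\<close>. If the
  ball around \<open>x\<close> meets the ball around \<open>s n\<close>, then one of the two contains both
  centres: either \<open>x\<close> lies in the ball around \<open>s n\<close>, or \<open>s n\<close> lies in the ball
  around \<open>x\<close> and so equals \<open>x\<close>. Hence the balls around the \<open>s n\<close> are disjoint, and
  their union is closed as well as open.
\<close>

lemma (in Ultrametric_space) noncompact_unbounded_locally_constant:
  assumes "\<not> compact_space mtopology"
  shows "\<exists>g :: 'a \<Rightarrow> nat. (\<forall>x\<in>M. \<exists>e>0. \<forall>y\<in>M. d x y < e \<longrightarrow> g y = g x) \<and>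
           (\<forall>n. \<exists>x\<in>M. n \<le> g x)"
proof -
  obtain S where S: "S \<subseteq> M" "infinite S" "mtopology derived_set_of S = {}"
    using assms unfolding compact_space_eq_Bolzano_Weierstrass by blast
  obtain s :: "nat \<Rightarrow> 'a" where s: "inj s" "range s \<subseteq> S"
    using infinite_countable_subset[OF S(2)] by blast
  have sM: "s n \<in> M" for n
    using s S by blast
  have "\<exists>r>0. \<forall>y\<in>S. d x y < r \<longrightarrow> y = x" if x: "x \<in> M" for x
  proof -
    have "x \<notin> mtopology derived_set_of S"
      using S(3) by blast
    then obtain r where "0 < r" "\<forall>y\<in>S. y \<noteq> x \<longrightarrow> y \<notin> mball x r"
      using x unfolding metric_derived_set_of by blast
    then show ?thesis
      using x S(1) by (metis in_mball subsetD)
  qed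
  then obtain r where r: "\<And>x. x \<in> M \<Longrightarrow> 0 < r x"
      "\<And>x y. x \<in> M \<Longrightarrow> y \<in> S \<Longrightarrow> d x y < r x \<Longrightarrow> y = x"
    by metis
  have absorb: "d (s n) x < r (s n)"
    if "x \<in> M" "z \<in> M" "d x z < r x" "d (s n) z < r (s n)" for x z n
  proof (cases "r x \<le> r (s n)")
    case True
    then show ?thesis
      using ultrametric[of "s n" x z] commute[of x z] that sM[of n] by linarith
  next
    case False
    then have "d x (s n) < r x"
      using ultrametric[of x "s n" z] commute[of z "s n"] that sM[of n] by linarith
    then have "s n = x"
      using r(2) s(2) that(1) by blast
    then show ?thesis
      using r(1) that(1) by simp
  qed
  have unique: "m = n"
    if "x \<in> M" "d (s m) x < r (s m)" "d (s n) x < r (s n)" for m n x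
  proof -
    have "d (s n) (s m) < r (s n)"
      using absorb[OF sM that] .
    then have "s m = s n"
      using r(2)[OF sM] s(2) by blast
    then show "m = n"
      using s(1) by (simp add: inj_eq)
  qed
  define g where "g x = (if \<exists>n. d (s n) x < r (s n) then THE n. d (s n) x < r (s n) else 0)" for x
  have g_ball: "g x = n" if "x \<in> M" "d (s n) x < r (s n)" for x n
    unfolding g_def using that unique by (auto intro!: the_equality)
  have "\<exists>e>0. \<forall>y\<in>M. d x y < e \<longrightarrow> g y = g x" if x: "x \<in> M" for x
  proof (cases "\<exists>n. d (s n) x < r (s n)")
    case True
    then obtain n where n: "d (s n) x < r (s n)"
      by blast
    have "g y = g x" if y: "y \<in> M" "d x y < r (s n)" for y
    proof -
      have "d (s n) y < r (s n)"
        using ultrametric[of "s n" y x] n x y sM[of n] by linarith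
      then show ?thesis
        using g_ball n x y(1) by simp
    qed
    then show ?thesis
      using r(1)[OF sM] by blast
  next
    case False
    have "g y = g x" if y: "y \<in> M" "d x y < r x" for y
    proof -
      have "\<not> (\<exists>n. d (s n) y < r (s n))"
        using absorb x y False by blast
      with False show ?thesis
        by (simp add: g_def)
    qed
    then show ?thesis
      using r(1)[OF x] by blast
  qed
  moreover have "\<exists>x\<in>M. n \<le> g x" for n
    using g_ball[of "s n" n] sM[of n] r(1)[OF sM, of n] by (intro bexI[of _ "s n"]) auto
  ultimately show ?thesis
    by blast
qed

text \<open>
  Points with different values \<open>a\<close>, \<open>b\<close> of the locally constant function are pushed to
  distance at least \<open>max a b\<close>. As \<open>max a b\<close> for \<open>a \<noteq> b\<close> is itself an ultrametric
  on the natural numbers, the result is again an ultrametric.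
\<close>

lemma noncompact_distance_set_without_largest:
  assumes "ultrametrizable \<tau>" and nc: "\<not> compact_space \<tau>"
  shows "\<exists>d. compatible_ultrametric \<tau> d \<and> \<not> has_largest_element (distance_set (topspace \<tau>) d)"
proof -
  define X where "X = topspace \<tau>"
  obtain d where d: "Ultrametric_space X d" "\<tau> = Metric_space.mtopology X d"
    using assms(1) unfolding ultrametrizable_def compatible_ultrametric_def X_def by blast
  interpret Ultrametric_space X d by (rule d(1))
  obtain g :: "'a \<Rightarrow> nat"
    where loc: "\<And>x. x \<in> X \<Longrightarrow> \<exists>e>0. \<forall>y\<in>X. d x y < e \<longrightarrow> g y = g x"
      and unb: "\<And>n. \<exists>x\<in>X. n \<le> g x"
    using noncompact_unbounded_locally_constant nc d(2) by metis
  define u where "u x y = (if g x = g y then 0 else real (max (g x) (g y)))" for x y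
  define \<rho> where "\<rho> x y = max (d x y) (u x y)" for x y
  have u: "u x y \<le> max (u x z) (u z y)" for x y z
    by (auto simp: u_def)
  have \<rho>: "\<rho> x y \<le> max (\<rho> x z) (\<rho> z y)" if "x \<in> X" "y \<in> X" "z \<in> X" for x y z
    using ultrametric[OF that] u[of x y z] unfolding \<rho>_def by linarith
  have \<rho>_nonneg: "0 \<le> \<rho> x y" for x y
    by (simp add: \<rho>_def le_max_iff_disj)
  have U: "Ultrametric_space X \<rho>"
  proof
    show "0 \<le> \<rho> x y" for x y
      by (rule \<rho>_nonneg)
    show "\<rho> x y = \<rho> y x" for x y
      by (simp add: \<rho>_def u_def commute max.commute)
    show "\<rho> x y = 0 \<longleftrightarrow> x = y" if "x \<in> X" "y \<in> X" for x y
    proof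
      assume "\<rho> x y = 0"
      then have "d x y = 0"
        using nonneg[of x y] unfolding \<rho>_def by linarith
      then show "x = y"
        using that by simp
    qed (use that in \<open>simp add: \<rho>_def u_def\<close>)
    show "\<rho> x z \<le> \<rho> x y + \<rho> y z" if "x \<in> X" "y \<in> X" "z \<in> X" for x y z
      using \<rho>[of x z y] \<rho>_nonneg[of x y] \<rho>_nonneg[of y z] that by linarith
  qed (rule \<rho>)
  have "Metric_space.mtopology X d = Metric_space.mtopology X \<rho>"
  proof (rule mtopology_eq_if_locally_eq)
    show "Metric_space X \<rho>"
      using U by (rule Ultrametric_space.axioms)
    fix x assume "x \<in> X"
    then obtain e where e: "0 < e" "\<And>y. y \<in> X \<Longrightarrow> d x y < e \<Longrightarrow> g y = g x"
      using loc by blast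
    have "d x y = \<rho> x y" if "y \<in> X" "d x y < e \<or> \<rho> x y < e" for y
    proof -
      have "g y = g x"
        using e(2) that by (auto simp: \<rho>_def)
      then show ?thesis
        by (simp add: \<rho>_def u_def)
    qed
    with e(1) show "\<exists>e>0. \<forall>y\<in>X. d x y < e \<or> \<rho> x y < e \<longrightarrow> d x y = \<rho> x y"
      by blast
  qed (rule Metric_space_axioms)
  then have "compatible_ultrametric \<tau> \<rho>"
    using U d(2) unfolding compatible_ultrametric_def X_def by simp
  moreover have "\<not> has_largest_element (distance_set X \<rho>)"
  proof
    assume "has_largest_element (distance_set X \<rho>)"
    then obtain m where m: "\<And>x y. x \<in> X \<Longrightarrow> y \<in> X \<Longrightarrow> \<rho> x y \<le> m"
      unfolding has_largest_element_def distance_set_def by blast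
    obtain a where a: "a \<in> X"
      using unb by blast
    obtain n where n: "m < real n"
      using reals_Archimedean2 by blast
    obtain b where b: "b \<in> X" "Suc (g a + n) \<le> g b"
      using unb by blast
    then have "real n \<le> u a b"
      unfolding u_def by auto
    then have "m < \<rho> a b"
      using n by (simp add: \<rho>_def)
    then show False
      using m[OF a b(1)] by simp
  qed
  ultimately show ?thesis
    unfolding X_def by blast
qed

section \<open>The equivalences\<close>

theorem theorem4p7:
  fixes X :: "'a set" and \<tau> :: "'a topology"
  assumes "topspace \<tau> = X" and "ultrametrizable \<tau>" and "infinite X"
  shows "(compact_space \<tau> \<longleftrightarrow>
            (\<forall>d. compatible_ultrametric \<tau> d \<longrightarrow>
                 has_order_type_one_plus_omega_star (distance_set X d)))
       \<and> (compact_space \<tau> \<longleftrightarrow>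
            (\<forall>d \<rho>. Ultrametric_space X d \<and> Ultrametric_space X \<rho> \<and>
                 Metric_space.mtopology X d = \<tau> \<and> \<tau> = Metric_space.mtopology X \<rho> \<longrightarrow>
                 order_isomorphic (distance_set X d) (distance_set X \<rho>)))
       \<and> (compact_space \<tau> \<longleftrightarrow>
            (\<forall>d. compatible_ultrametric \<tau> d \<longrightarrow> has_largest_element (distance_set X d)))"
proof -
  have iso: "(Ultrametric_space X d \<and> Ultrametric_space X \<rho> \<and>
      Metric_space.mtopology X d = \<tau> \<and> \<tau> = Metric_space.mtopology X \<rho>) \<longleftrightarrow>
      compatible_ultrametric \<tau> d \<and> compatible_ultrametric \<tau> \<rho>" for d \<rho>
    using assms(1) unfolding compatible_ultrametric_def by auto
  have largest: "has_largest_element A" if "has_order_type_one_plus_omega_star A" for A :: "real set"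
    using that has_largest_element_one_plus_omega_star has_largest_element_order_isomorphic
      order_isomorphic_sym
    unfolding has_order_type_one_plus_omega_star_def by blast
  show ?thesis
  proof (cases "compact_space \<tau>")
    case True
    have type: "has_order_type_one_plus_omega_star (distance_set X d)"
      if "compatible_ultrametric \<tau> d" for d
      using compact_distance_set_order_type[OF True _ that] assms by simp
    moreover have "order_isomorphic (distance_set X d) (distance_set X \<rho>)"
      if "compatible_ultrametric \<tau> d" "compatible_ultrametric \<tau> \<rho>" for d \<rho>
      using type[OF that(1)] type[OF that(2)] order_isomorphic_trans order_isomorphic_sym
      unfolding has_order_type_one_plus_omega_star_def by blast
    ultimately show ?thesis
      unfolding iso using True largest by blast
  next
    case False
    obtain d where d: "compatible_ultrametric \<tau> d" "\<not> has_largest_element (distance_set X d)"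
      using noncompact_distance_set_without_largest[OF assms(2) False] assms(1) by blast
    obtain \<rho> where \<rho>: "compatible_ultrametric \<tau> \<rho>" "has_largest_element (distance_set X \<rho>)"
      using compatible_ultrametric_with_largest[OF assms(2)] assms(1,3) by blast
    have "\<not> order_isomorphic (distance_set X \<rho>) (distance_set X d)"
      using d(2) \<rho>(2) has_largest_element_order_isomorphic by blast
    then show ?thesis
      unfolding iso using False d \<rho>(1) largest by blast
  qed
qed

end
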